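(* An extension $A\subset E$ of unital associative algebras over a field $k$ has a retraction that is an algebra map if and only if there exists an isomorphism of algebras $E\cong A\# V$, where $A\# V$ is a semidirect product of algebras (associated to some semidirect system $\Omega(A,V)=(\triangleleft,\rightharpoonup,\cdot)$ of $A$ and a vector space $V$).
   Context: All vector spaces, linear and bilinear maps are over an arbitrary field $k$. "Algebra" means unital associative $k$-algebra unless stated otherwise; algebra maps preserve units; modules are unital. A retraction is a linear map $p:E\to A$ with $p(a)=a$ for all $a\in A$. A semidirect system of algebras $\Omega(A,V)=(\triangleleft,\rightharpoonup,\cdot)$ consists of bilinear maps $\triangleleft:V\times A\to V$, $\rightharpoonup:A\times V\to V$, $\cdot:V\times V\to V$ such that $(V,\rightharpoonup,\triangleleft)$ is an $A$-bimodule (left action $\rightharpoonup$, right action $\triangleleft$), $(V,\cdot)$ is an associative, not necessarily unital, algebra, and for all $a\in A$, $x,y\in V$: $a\rightharpoonup(x\cdot y)=(a\rightharpoonup x)\cdot y$, $(x\cdot y)\triangleleft a=x\cdot(y\triangleleft a)$, $x\cdot(a\rightharpoonup y)=(x\triangleleft a)\cdot y$. The semidirect product $A\# V$ is the vector space $A\times V$ with the (associative, with unit $(1_A,0)$) multiplication $$(a,x)\bullet(b,y)=\bigl(ab,\ a\rightharpoonup y+x\triangleleft b+x\cdot y\bigr).$$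
   Formalization: The isomorphism E ≅ A # V is required to send each a in A to (a, 0); with an arbitrary algebra isomorphism the "if" direction is false, e.g. A = k[X²] in E = k[X] with V = 0. *)

theory Defs
  imports "HOL-Algebra.Module" "HOL-Algebra.Subrings"
begin

text \<open>
  The locale \<^locale>\<open>algebra\<close> of HOL-Algebra only covers commutative algebras, so unital associative
  algebras over a field are introduced here.  The zero algebra is allowed, as \<^locale>\<open>ring\<close> does not
  require \<open>\<one> \<noteq> \<zero>\<close>.
\<close>

locale unital_algebra = K?: field K + E?: module K E + E?: ring E
  for K (structure) and E (structure) +
  assumes smult_mult_left:
      "\<lbrakk> c \<in> carrier K; x \<in> carrier E; y \<in> carrier E \<rbrakk> \<Longrightarrow>
        (c \<odot>\<^bsub>E\<^esub> x) \<otimes>\<^bsub>E\<^esub> y = c \<odot>\<^bsub>E\<^esub> (x \<otimes>\<^bsub>E\<^esub> y)"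
    and smult_mult_right:
      "\<lbrakk> c \<in> carrier K; x \<in> carrier E; y \<in> carrier E \<rbrakk> \<Longrightarrow>
        x \<otimes>\<^bsub>E\<^esub> (c \<odot>\<^bsub>E\<^esub> y) = c \<odot>\<^bsub>E\<^esub> (x \<otimes>\<^bsub>E\<^esub> y)"

text \<open>Being a \<^locale>\<open>subring\<close>, a subalgebra contains the unit of the big algebra.\<close>

definition subalg :: "('k, 'm) ring_scheme \<Rightarrow> ('k, 'e, 'n) module_scheme \<Rightarrow> 'e set \<Rightarrow> bool" where
  "subalg K E A \<longleftrightarrow> subring A E \<and> submodule A K E"

definition linear_maps ::
  "('k, 'm) ring_scheme \<Rightarrow> ('k, 'e, 'n) module_scheme \<Rightarrow> ('k, 'f, 'p) module_scheme \<Rightarrow> ('e \<Rightarrow> 'f) set" where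
  "linear_maps K E F = {h \<in> carrier E \<rightarrow> carrier F.
     (\<forall>x\<in>carrier E. \<forall>y\<in>carrier E. h (x \<oplus>\<^bsub>E\<^esub> y) = h x \<oplus>\<^bsub>F\<^esub> h y) \<and>
     (\<forall>c\<in>carrier K. \<forall>x\<in>carrier E. h (c \<odot>\<^bsub>E\<^esub> x) = c \<odot>\<^bsub>F\<^esub> h x)}"

definition bilinear_maps ::
  "('k, 'm) ring_scheme \<Rightarrow> ('k, 'e, 'n) module_scheme \<Rightarrow> ('k, 'f, 'p) module_scheme \<Rightarrow>
    ('k, 'g, 'q) module_scheme \<Rightarrow> ('e \<Rightarrow> 'f \<Rightarrow> 'g) set" where
  "bilinear_maps K E F G = {h.
     (\<forall>x\<in>carrier E. h x \<in> linear_maps K F G) \<and>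
     (\<forall>y\<in>carrier F. (\<lambda>x. h x y) \<in> linear_maps K E G)}"

definition algebra_hom ::
  "('k, 'm) ring_scheme \<Rightarrow> ('k, 'e, 'n) module_scheme \<Rightarrow> ('k, 'f, 'p) module_scheme \<Rightarrow> ('e \<Rightarrow> 'f) set" where
  "algebra_hom K E F = ring_hom E F \<inter> linear_maps K E F"

definition algebra_iso ::
  "('k, 'm) ring_scheme \<Rightarrow> ('k, 'e, 'n) module_scheme \<Rightarrow> ('k, 'f, 'p) module_scheme \<Rightarrow> ('e \<Rightarrow> 'f) set" where
  "algebra_iso K E F = {h \<in> algebra_hom K E F. bij_betw h (carrier E) (carrier F)}"

definition retraction_onto ::
  "('k, 'm) ring_scheme \<Rightarrow> ('k, 'e, 'n) module_scheme \<Rightarrow> 'e set \<Rightarrow> ('e \<Rightarrow> 'e) \<Rightarrow> bool" where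
  "retraction_onto K E A p \<longleftrightarrow>
     p \<in> linear_maps K E (E\<lparr>carrier := A\<rparr>) \<and> (\<forall>a\<in>A. p a = a)"

text \<open>
  A semidirect system: \<open>ract x a\<close> is \<open>x \<triangleleft> a\<close>, \<open>lact a x\<close> is \<open>a \<rightharpoonup> x\<close> and \<open>vmul x y\<close> is \<open>x \<cdot> y\<close>.
  Only the vector space part of the record \<open>V\<close> is used; its fields \<open>mult\<close> and \<open>one\<close> are irrelevant.
\<close>

locale semidirect_system = A?: unital_algebra K A + V?: module K V
  for K :: "('k, 'm) ring_scheme" (structure)
    and A :: "('k, 'a, 'n) module_scheme" (structure)
    and V :: "('k, 'v, 'p) module_scheme" (structure)
    and ract :: "'v \<Rightarrow> 'a \<Rightarrow> 'v" (infixl \<open>\<triangleleft>\<close> 70)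
    and lact :: "'a \<Rightarrow> 'v \<Rightarrow> 'v" (infixr \<open>\<rightharpoonup>\<close> 70)
    and vmul :: "'v \<Rightarrow> 'v \<Rightarrow> 'v" (infixl \<open>\<bullet>\<close> 70) +
  assumes ract_bilinear: "ract \<in> bilinear_maps K V A V"
    and lact_bilinear: "lact \<in> bilinear_maps K A V V"
    and vmul_bilinear: "vmul \<in> bilinear_maps K V V V"
    and lact_one: "x \<in> carrier V \<Longrightarrow> \<one>\<^bsub>A\<^esub> \<rightharpoonup> x = x"
    and lact_mult: "\<lbrakk> a \<in> carrier A; b \<in> carrier A; x \<in> carrier V \<rbrakk> \<Longrightarrow>
          (a \<otimes>\<^bsub>A\<^esub> b) \<rightharpoonup> x = a \<rightharpoonup> (b \<rightharpoonup> x)"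
    and ract_one: "x \<in> carrier V \<Longrightarrow> x \<triangleleft> \<one>\<^bsub>A\<^esub> = x"
    and ract_mult: "\<lbrakk> a \<in> carrier A; b \<in> carrier A; x \<in> carrier V \<rbrakk> \<Longrightarrow>
          x \<triangleleft> (a \<otimes>\<^bsub>A\<^esub> b) = (x \<triangleleft> a) \<triangleleft> b"
    and lact_ract: "\<lbrakk> a \<in> carrier A; b \<in> carrier A; x \<in> carrier V \<rbrakk> \<Longrightarrow>
          (a \<rightharpoonup> x) \<triangleleft> b = a \<rightharpoonup> (x \<triangleleft> b)"
    and vmul_assoc: "\<lbrakk> x \<in> carrier V; y \<in> carrier V; z \<in> carrier V \<rbrakk> \<Longrightarrow>
          (x \<bullet> y) \<bullet> z = x \<bullet> (y \<bullet> z)"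
    and lact_vmul: "\<lbrakk> a \<in> carrier A; x \<in> carrier V; y \<in> carrier V \<rbrakk> \<Longrightarrow>
          a \<rightharpoonup> (x \<bullet> y) = (a \<rightharpoonup> x) \<bullet> y"
    and vmul_ract: "\<lbrakk> a \<in> carrier A; x \<in> carrier V; y \<in> carrier V \<rbrakk> \<Longrightarrow>
          (x \<bullet> y) \<triangleleft> a = x \<bullet> (y \<triangleleft> a)"
    and vmul_balanced: "\<lbrakk> a \<in> carrier A; x \<in> carrier V; y \<in> carrier V \<rbrakk> \<Longrightarrow>
          x \<bullet> (a \<rightharpoonup> y) = (x \<triangleleft> a) \<bullet> y"

definition semidirect_product ::
  "('k, 'a, 'm) module_scheme \<Rightarrow> ('k, 'v, 'n) module_scheme \<Rightarrow>
    ('v \<Rightarrow> 'a \<Rightarrow> 'v) \<Rightarrow> ('a \<Rightarrow> 'v \<Rightarrow> 'v) \<Rightarrow> ('v \<Rightarrow> 'v \<Rightarrow> 'v) \<Rightarrow> ('k, 'a \<times> 'v) module" where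
  "semidirect_product A V ract lact vmul =
    \<lparr>carrier = carrier A \<times> carrier V,
     mult = (\<lambda>(a, x) (b, y). (a \<otimes>\<^bsub>A\<^esub> b, lact a y \<oplus>\<^bsub>V\<^esub> ract x b \<oplus>\<^bsub>V\<^esub> vmul x y)),
     one = (\<one>\<^bsub>A\<^esub>, \<zero>\<^bsub>V\<^esub>),
     zero = (\<zero>\<^bsub>A\<^esub>, \<zero>\<^bsub>V\<^esub>),
     add = (\<lambda>(a, x) (b, y). (a \<oplus>\<^bsub>A\<^esub> b, x \<oplus>\<^bsub>V\<^esub> y)),
     smult = (\<lambda>c (a, x). (c \<odot>\<^bsub>A\<^esub> a, c \<odot>\<^bsub>V\<^esub> x))\<rparr>"

text \<open>
  The isomorphism has to be one of extensions of \<open>A\<close>: it carries the inclusion of \<open>A\<close> in \<open>E\<close> to the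
  canonical map \<open>a \<mapsto> (a, 0)\<close>.  Without this a splitting could not be recovered from it: the subalgebra
  \<open>k[X\<^sup>2]\<close> of \<open>k[X]\<close> is abstractly isomorphic to \<open>k[X]\<close>, that is, \<open>k[X]\<close> is isomorphic to the
  semidirect product of \<open>k[X\<^sup>2]\<close> and the zero space, but no algebra map is a retraction of \<open>k[X]\<close>
  onto \<open>k[X\<^sup>2]\<close>.
\<close>

definition iso_to_semidirect ::
  "('k, 'm) ring_scheme \<Rightarrow> ('k, 'e, 'n) module_scheme \<Rightarrow> 'e set \<Rightarrow> ('k, 'v, 'p) module_scheme \<Rightarrow>
    ('v \<Rightarrow> 'e \<Rightarrow> 'v) \<Rightarrow> ('e \<Rightarrow> 'v \<Rightarrow> 'v) \<Rightarrow> ('v \<Rightarrow> 'v \<Rightarrow> 'v) \<Rightarrow> bool" where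
  "iso_to_semidirect K E A V ract lact vmul \<longleftrightarrow>
    (\<exists>\<phi> \<in> algebra_iso K E (semidirect_product (E\<lparr>carrier := A\<rparr>) V ract lact vmul).
       \<forall>a\<in>A. \<phi> a = (a, \<zero>\<^bsub>V\<^esub>))"

end

theory Submission
  imports Defs "HOL-Algebra.RingHom"
begin

text \<open>
  If \<open>p\<close> is an algebra retraction, then \<open>ker p\<close> is an ideal complementing \<open>A\<close>; with all operations
  inherited from \<open>E\<close>, it forms a semidirect system, and \<open>x \<mapsto> (p x, x - p x)\<close> is the isomorphism.
  Conversely, the first projection of \<open>A # V\<close> is an algebra map onto \<open>A\<close>, so its composite with an
  isomorphism of extensions is a retraction.
\<close>

text \<open>The main theorem asks for \<open>V\<close> of type \<open>('k, 'e) module\<close>,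
  whereas \<open>E\<close> may carry extra record fields. Truncation drops those fields and keeps
  every operation.\<close>

lemma (in module) module_truncate: "module R (module.truncate M)"
  using M.l_neg
  by (intro moduleI abelian_groupI R.cring_axioms)
     (auto simp: module.truncate_def M.a_ac smult_l_distr smult_r_distr smult_assoc1)

lemma linear_mapsI:
  assumes "\<And>x. x \<in> carrier E \<Longrightarrow> h x \<in> carrier F"
    and "\<And>x y. \<lbrakk> x \<in> carrier E; y \<in> carrier E \<rbrakk> \<Longrightarrow> h (x \<oplus>\<^bsub>E\<^esub> y) = h x \<oplus>\<^bsub>F\<^esub> h y"
    and "\<And>c x. \<lbrakk> c \<in> carrier K; x \<in> carrier E \<rbrakk> \<Longrightarrow> h (c \<odot>\<^bsub>E\<^esub> x) = c \<odot>\<^bsub>F\<^esub> h x"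
  shows "h \<in> linear_maps K E F"
  using assms by (auto simp: linear_maps_def)

lemma linear_mapsD:
  assumes "h \<in> linear_maps K E F"
  shows "x \<in> carrier E \<Longrightarrow> h x \<in> carrier F"
    and "\<lbrakk> x \<in> carrier E; y \<in> carrier E \<rbrakk> \<Longrightarrow> h (x \<oplus>\<^bsub>E\<^esub> y) = h x \<oplus>\<^bsub>F\<^esub> h y"
    and "\<lbrakk> c \<in> carrier K; x \<in> carrier E \<rbrakk> \<Longrightarrow> h (c \<odot>\<^bsub>E\<^esub> x) = c \<odot>\<^bsub>F\<^esub> h x"
  using assms by (auto simp: linear_maps_def)

lemma (in unital_algebra) subalg_unital_algebra:
  assumes "subalg K E A"
  shows "unital_algebra K (E\<lparr>carrier := A\<rparr>)"
proof -
  have sub: "subring A E" "submodule A K E"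
    using assms by (simp_all add: subalg_def)
  interpret EA: ring "E\<lparr>carrier := A\<rparr>"
    by (rule E.subring_is_ring[OF sub(1)])
  interpret MA: module K "E\<lparr>carrier := A\<rparr>"
    by (rule submodule.submodule_is_module[OF sub(2) E.module_axioms])
  show ?thesis
    using subringE(1)[OF sub(1)]
    by unfold_locales (auto simp: smult_mult_left smult_mult_right subset_iff)
qed

text \<open>Stated for three records sharing the linear operations of \<open>E\<close>, so that both
  actions and the product on \<open>V\<close> are instances differing only in carriers.\<close>

lemma (in unital_algebra) mult_bilinear_maps:
  assumes "carrier U \<subseteq> carrier E" "carrier V \<subseteq> carrier E"
    and "\<And>x y. \<lbrakk> x \<in> carrier U; y \<in> carrier V \<rbrakk> \<Longrightarrow> x \<otimes>\<^bsub>E\<^esub> y \<in> carrier W"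
    and "add U = add E" "add V = add E" "add W = add E"
    and "smult U = smult E" "smult V = smult E" "smult W = smult E"
  shows "(\<otimes>\<^bsub>E\<^esub>) \<in> bilinear_maps K U V W"
  using assms
  by (auto simp: bilinear_maps_def linear_maps_def smult_mult_left smult_mult_right subset_iff
      E.l_distr E.r_distr)

text \<open>All three operations are the product of \<open>E\<close>, so each bimodule or
  compatibility law is associativity or a unit law in \<open>E\<close>; the ideal property keeps the
  results in \<open>N\<close>.\<close>

lemma (in unital_algebra) ideal_semidirect_system:
  assumes "subalg K E A" and "ideal N E" and "submodule N K E"
  shows "semidirect_system K (E\<lparr>carrier := A\<rparr>) (module.truncate (E\<lparr>carrier := N\<rparr>))
           (\<otimes>\<^bsub>E\<^esub>) (\<otimes>\<^bsub>E\<^esub>) (\<otimes>\<^bsub>E\<^esub>)"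
    (is "semidirect_system K ?A ?V _ _ _")
proof -
  interpret A: unital_algebra K "E\<lparr>carrier := A\<rparr>"
    by (rule subalg_unital_algebra[OF assms(1)])
  interpret V: module K "module.truncate (E\<lparr>carrier := N\<rparr>)"
    by (intro module.module_truncate submodule.submodule_is_module[OF assms(3)] E.module_axioms)
  have A: "a \<in> carrier E" if "a \<in> A" for a
    using assms(1) that by (auto simp: subalg_def dest: subringE(1))
  have N: "x \<in> carrier E" if "x \<in> N" for x
    by (rule ideal.Icarr[OF assms(2) that])
  note NI = ideal.I_l_closed[OF assms(2)] ideal.I_r_closed[OF assms(2)]
  have "(\<otimes>\<^bsub>E\<^esub>) \<in> bilinear_maps K ?V ?A ?V" "(\<otimes>\<^bsub>E\<^esub>) \<in> bilinear_maps K ?A ?V ?V"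
    "(\<otimes>\<^bsub>E\<^esub>) \<in> bilinear_maps K ?V ?V ?V"
    by (rule mult_bilinear_maps; auto simp: module.truncate_def A N NI)+
  then show ?thesis
    by unfold_locales (simp_all add: module.truncate_def A N NI E.m_assoc)
qed

text \<open>The additive half of the submodule claim comes from the ideal; closure under scalars is
  p(cx) = c p(x) = c0 = 0.\<close>

lemma (in unital_algebra) algebra_hom_kernel:
  assumes "unital_algebra K F" and "p \<in> algebra_hom K E F"
  shows "ideal (a_kernel E F p) E" and "submodule (a_kernel E F p) K E"
proof -
  interpret F: unital_algebra K F by (rule assms(1))
  have p: "p \<in> ring_hom E F" "p \<in> linear_maps K E F"
    using assms(2) by (auto simp: algebra_hom_def)
  interpret p: ring_hom_ring E F p
    using p(1) by unfold_locales (auto simp: ring_hom_def)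
  show I: "ideal (a_kernel E F p) E"
    by (rule p.kernel_is_ideal)
  have "c \<odot>\<^bsub>E\<^esub> x \<in> a_kernel E F p" if "c \<in> carrier K" "x \<in> a_kernel E F p" for c x
    using that linear_mapsD(3)[OF p(2) that(1), of x] F.smult_r_null[OF that(1)]
      E.smult_closed[OF that(1), of x]
    unfolding a_kernel_def' mem_Collect_eq by metis
  moreover have "subgroup (a_kernel E F p) (add_monoid E)"
    using ideal.axioms(1)[OF I] by (rule additive_subgroup.a_subgroup)
  ultimately show "submodule (a_kernel E F p) K E"
    unfolding submodule_def submodule_axioms_def by blast
qed

text \<open>Every element splits as a + v with a in \<open>A\<close> and v in \<open>N\<close>, and
  (a + v)(b + w) = ab + (aw + vb + vw) is precisely the multiplication of the semidirect
  product.\<close>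

lemma (in unital_algebra) iso_to_kernel_semidirect:
  assumes A: "subalg K E A"
    and ret: "retraction_onto K E A p" and hom: "p \<in> algebra_hom K E (E\<lparr>carrier := A\<rparr>)"
  defines "N \<equiv> a_kernel E (E\<lparr>carrier := A\<rparr>) p"
  shows "iso_to_semidirect K E A (module.truncate (E\<lparr>carrier := N\<rparr>))
           (\<otimes>\<^bsub>E\<^esub>) (\<otimes>\<^bsub>E\<^esub>) (\<otimes>\<^bsub>E\<^esub>)"
proof -
  let ?S = "semidirect_product (E\<lparr>carrier := A\<rparr>) (module.truncate (E\<lparr>carrier := N\<rparr>))
              (\<otimes>\<^bsub>E\<^esub>) (\<otimes>\<^bsub>E\<^esub>) (\<otimes>\<^bsub>E\<^esub>)"
  define \<phi> where "\<phi> x = (p x, x \<ominus>\<^bsub>E\<^esub> p x)" for x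
  have AE: "a \<in> carrier E" if "a \<in> A" for a
    using A that by (auto simp: subalg_def dest: subringE(1))
  have p_ring: "p \<in> ring_hom E (E\<lparr>carrier := A\<rparr>)"
    and lin: "p \<in> linear_maps K E (E\<lparr>carrier := A\<rparr>)"
    using hom by (auto simp: algebra_hom_def)
  have p_A: "p x \<in> A" if "x \<in> carrier E" for x
    using linear_mapsD(1)[OF lin] that by simp
  note p_E = AE[OF p_A]
  have p_fix: "p a = a" if "a \<in> A" for a
    using ret that by (simp add: retraction_onto_def)
  have p_add: "p (x \<oplus>\<^bsub>E\<^esub> y) = p x \<oplus>\<^bsub>E\<^esub> p y" if "x \<in> carrier E" "y \<in> carrier E" for x y
    using linear_mapsD(2)[OF lin] that by simp
  have p_smult: "p (c \<odot>\<^bsub>E\<^esub> x) = c \<odot>\<^bsub>E\<^esub> p x" if "c \<in> carrier K" "x \<in> carrier E" for c x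
    using linear_mapsD(3)[OF lin] that by simp
  have p_mult: "p (x \<otimes>\<^bsub>E\<^esub> y) = p x \<otimes>\<^bsub>E\<^esub> p y" if "x \<in> carrier E" "y \<in> carrier E" for x y
    using ring_hom_mult[OF p_ring] that by simp
  have p_one: "p \<one>\<^bsub>E\<^esub> = \<one>\<^bsub>E\<^esub>"
    using ring_hom_one[OF p_ring] by simp
  have N_iff: "x \<in> N \<longleftrightarrow> x \<in> carrier E \<and> p x = \<zero>\<^bsub>E\<^esub>" for x
    by (auto simp: N_def a_kernel_def')
  have p_compl: "x \<ominus>\<^bsub>E\<^esub> p x \<in> N" if x: "x \<in> carrier E" for x
  proof -
    let ?d = "x \<ominus>\<^bsub>E\<^esub> p x"
    have d: "?d \<in> carrier E" using x p_E by simp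
    \<comment> \<open>Only additivity and p(p x) = p x enter: applying \<open>p\<close> to d + p x =
      x gives p d + p x = p x, and p x cancels.\<close>
    have "p ?d \<oplus>\<^bsub>E\<^esub> p x = p (?d \<oplus>\<^bsub>E\<^esub> p x)"
      using d x p_E p_A by (simp add: p_add p_fix)
    also have "?d \<oplus>\<^bsub>E\<^esub> p x = x"
      using x p_E by (simp add: E.M.minus_eq E.M.a_assoc E.M.l_neg)
    finally have "p ?d \<oplus>\<^bsub>E\<^esub> p x = p x" .
    then have "p ?d = \<zero>\<^bsub>E\<^esub>"
      using d x p_E by simp
    then show ?thesis using d by (simp add: N_iff)
  qed
  have cancel: "a \<oplus>\<^bsub>E\<^esub> (v \<oplus>\<^bsub>E\<^esub> \<ominus>\<^bsub>E\<^esub> a) = v" if "a \<in> carrier E" "v \<in> carrier E" for a v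
    using that by (simp add: E.M.a_lcomm[of a v] E.M.r_neg)
  have "\<phi> \<in> ring_hom E ?S"
  proof (rule ring_hom_memI)
    fix x y assume x: "x \<in> carrier E" and y: "y \<in> carrier E"
    note c = x y p_E[OF x] p_E[OF y]
    show "\<phi> x \<in> carrier ?S"
      using x by (simp add: \<phi>_def semidirect_product_def module.truncate_def p_A p_compl)
    \<comment> \<open>With u = x - p x and v = y - p y, the second components agree because xy - (p
      x)(p y) = (p x)v + u(p y) + uv.\<close>
    show "\<phi> (x \<otimes>\<^bsub>E\<^esub> y) = \<phi> x \<otimes>\<^bsub>?S\<^esub> \<phi> y"
      using c by (simp add: \<phi>_def semidirect_product_def module.truncate_def p_mult) algebra
    show "\<phi> (x \<oplus>\<^bsub>E\<^esub> y) = \<phi> x \<oplus>\<^bsub>?S\<^esub> \<phi> y"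
      using c by (simp add: \<phi>_def semidirect_product_def module.truncate_def p_add) algebra
  next
    show "\<phi> \<one>\<^bsub>E\<^esub> = \<one>\<^bsub>?S\<^esub>"
      by (simp add: \<phi>_def semidirect_product_def module.truncate_def p_one E.M.minus_eq E.M.r_neg)
  qed
  \<comment> \<open>Closure and additivity are part of \<open>ring_hom\<close>; only the scalar law
    is computed.\<close>
  moreover from this have "\<phi> \<in> linear_maps K E ?S"
    by (intro linear_mapsI)
       (auto simp: ring_hom_def, simp add: \<phi>_def semidirect_product_def module.truncate_def p_smult
          E.M.minus_eq E.smult_r_distr E.smult_r_minus p_E)
  moreover have "bij_betw \<phi> (carrier E) (carrier ?S)"
  \<comment> \<open>The inverse recombines the two parts. For a in \<open>A\<close> and v in
    \<open>N\<close>, p(a + v) = a + 0 = a, and \<open>cancel\<close> recovers v as (a + v) -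
    a.\<close>
  proof (rule bij_betw_byWitness[where f' = "\<lambda>(a, v). a \<oplus>\<^bsub>E\<^esub> v"])
    show "\<forall>x\<in>carrier E. (case \<phi> x of (a, v) \<Rightarrow> a \<oplus>\<^bsub>E\<^esub> v) = x"
      by (auto simp: \<phi>_def p_E E.M.minus_eq cancel)
    show "\<forall>s\<in>carrier ?S. \<phi> (case s of (a, v) \<Rightarrow> a \<oplus>\<^bsub>E\<^esub> v) = s"
      by (auto simp: \<phi>_def semidirect_product_def module.truncate_def AE N_iff p_add p_fix
            E.M.minus_eq E.M.a_assoc cancel)
    show "\<phi> ` carrier E \<subseteq> carrier ?S"
      by (auto simp: \<phi>_def semidirect_product_def module.truncate_def p_A p_compl)
    show "(\<lambda>(a, v). a \<oplus>\<^bsub>E\<^esub> v) ` carrier ?S \<subseteq> carrier E"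
      by (auto simp: semidirect_product_def module.truncate_def AE N_iff)
  qed
  moreover have "\<phi> a = (a, \<zero>\<^bsub>module.truncate (E\<lparr>carrier := N\<rparr>)\<^esub>)" if "a \<in> A" for a
    using that by (simp add: \<phi>_def module.truncate_def p_fix AE E.M.minus_eq E.M.r_neg)
  ultimately show ?thesis
    unfolding iso_to_semidirect_def algebra_iso_def algebra_hom_def by blast
qed

text \<open>The actions and the product on \<open>V\<close> affect only second components; on first
  components every operation is that of \<open>A\<close>.\<close>

lemma fst_semidirect_algebra_hom:
  "fst \<in> algebra_hom K (semidirect_product A V ract lact vmul) A"
  by (auto simp: algebra_hom_def ring_hom_def linear_maps_def semidirect_product_def)

lemma algebra_hom_comp:
  assumes "f \<in> algebra_hom K E F" "g \<in> algebra_hom K F G"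
  shows "g \<circ> f \<in> algebra_hom K E G"
  using assms
  by (auto simp: algebra_hom_def linear_maps_def Pi_iff intro: ring_hom_trans)

text \<open>The compatibility \<phi>(a) = (a, 0) is what makes \<open>fst \<circ> \<phi>\<close> fix
  \<open>A\<close> pointwise.\<close>

lemma iso_to_semidirect_retraction:
  assumes "iso_to_semidirect K E A V ract lact vmul"
  shows "\<exists>p. retraction_onto K E A p \<and> p \<in> algebra_hom K E (E\<lparr>carrier := A\<rparr>)"
proof -
  obtain \<phi> where
    \<phi>: "\<phi> \<in> algebra_hom K E (semidirect_product (E\<lparr>carrier := A\<rparr>) V ract lact vmul)"
    and \<phi>_A: "\<And>a. a \<in> A \<Longrightarrow> \<phi> a = (a, \<zero>\<^bsub>V\<^esub>)"
    using assms by (auto simp: iso_to_semidirect_def algebra_iso_def)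
  have "fst \<circ> \<phi> \<in> algebra_hom K E (E\<lparr>carrier := A\<rparr>)"
    by (rule algebra_hom_comp[OF \<phi> fst_semidirect_algebra_hom])
  then show ?thesis
    using \<phi>_A by (intro exI[of _ "fst \<circ> \<phi>"]) (simp add: retraction_onto_def algebra_hom_def)
qed

text \<open>An existential in HOL cannot range over types. In the equivalence \<open>V\<close> lives
  on the type of \<open>E\<close>, which suffices because the kernel of \<open>p\<close> lies in
  \<open>E\<close>; the second conjunct gives the converse for \<open>V\<close> over an arbitrary
  type.\<close>

theorem corollary2p8:
  fixes K :: "('k, 'm) ring_scheme"
    and E :: "('k, 'e, 'n) module_scheme"
    and A :: "'e set"
  assumes "unital_algebra K E"
    and "subalg K E A"
  shows "((\<exists>p. retraction_onto K E A p \<and> p \<in> algebra_hom K E (E\<lparr>carrier := A\<rparr>)) \<longleftrightarrow>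
          (\<exists>(V :: ('k, 'e) module) ract lact vmul.
             semidirect_system K (E\<lparr>carrier := A\<rparr>) V ract lact vmul \<and>
             iso_to_semidirect K E A V ract lact vmul)) \<and>
         (\<forall>(V :: ('k, 'v) module) ract lact vmul.
             semidirect_system K (E\<lparr>carrier := A\<rparr>) V ract lact vmul \<and>
             iso_to_semidirect K E A V ract lact vmul \<longrightarrow>
             (\<exists>p. retraction_onto K E A p \<and> p \<in> algebra_hom K E (E\<lparr>carrier := A\<rparr>)))"
proof (intro conjI iffI)
  interpret E: unital_algebra K E by (rule assms(1))
  assume "\<exists>p. retraction_onto K E A p \<and> p \<in> algebra_hom K E (E\<lparr>carrier := A\<rparr>)"
  then obtain p where p: "retraction_onto K E A p" "p \<in> algebra_hom K E (E\<lparr>carrier := A\<rparr>)"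
    by blast
  note ker = E.algebra_hom_kernel[OF E.subalg_unital_algebra[OF assms(2)] p(2)]
  show "\<exists>(V :: ('k, 'e) module) ract lact vmul.
          semidirect_system K (E\<lparr>carrier := A\<rparr>) V ract lact vmul \<and>
          iso_to_semidirect K E A V ract lact vmul"
    using E.ideal_semidirect_system[OF assms(2) ker] E.iso_to_kernel_semidirect[OF assms(2) p]
    by blast
\<comment> \<open>The two remaining goals are the converse implication and its version for arbitrary
  \<open>'v\<close>.\<close>
qed (use iso_to_semidirect_retraction in blast)+

end
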